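(* Let $(A,d_A)$, $(B,d_B)$, $(C,d_C)$ be premetric spaces, let $f:A\to B$ be an isometric embedding, and let $h:A\to C$ be an isometric embedding with dense image. Then there exists a unique isometric embedding $g:C\to\widehat{B}$ such that $g\circ h=i\circ f$, where $i:B\to\widehat{B}$ is the map $i(b)=b^*$.
   Context: A premetric on a nonempty set $X$ is a relation $d$ between $X\times X$ and the nonnegative rationals, written $d(x,y)\leq q$, such that for all $x,y,z\in X$ and nonnegative rationals $p,q$: (1) $d(x,y)\leq 0$ iff $x=y$; (2) $d(x,y)\leq q$ implies $d(y,x)\leq q$; (3) $d(x,z)\leq p$ and $d(z,y)\leq q$ imply $d(x,y)\leq p+q$; (4) $d(x,y)\leq p$ iff $d(x,y)\leq q$ for all rationals $q>p$. For $S\subseteq X$, $\operatorname{diam} S\leq q$ means $d(x,y)\leq q$ for all $x,y\in S$. A Cauchy family on $X$ is $F\subseteq\mathcal{P}(X)$ with (i) $S\cap T\neq\emptyset$ for all $S,T\in F$ and (ii) for every rational $\varepsilon>0$ some $S\in F$ has $\operatorname{diam} S\leq\varepsilon$. For Cauchy families $F,F'$, $d(F,F')\leq q$ means: for every rational $\varepsilon>0$ there exist $S\in F$, $T\in F'$ with $\operatorname{diam} S,\operatorname{diam} T\leq\varepsilon$ and $\operatorname{diam}(S\cup T)\leq q+\varepsilon$. This is a pseudo-premetric; $F\sim F'$ iff $d(F,F')\leq 0$ is an equivalence relation; $\widehat{X}$ is the set of classes $[F]$ with premetric $\widehat{d}([F],[F'])\leq q$ iff $d(F,F')\leq q$; $x^*$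 denotes the class of $\{\{x\}\}$. A map $f:(X,d_X)\to(Y,d_Y)$ is an isometric embedding if $d_X(x,x')\leq q\iff d_Y(f(x),f(x'))\leq q$ for all $x,x'$ and nonnegative rationals $q$. A subset $D\subseteq Y$ is dense if for every rational $\varepsilon>0$ and $y\in Y$ there is $z\in D$ with $d_Y(z,y)\leq\varepsilon$. *)

theory Defs
  imports Complex_Main "HOL-Library.FuncSet"
begin

text \<open>
  A premetric is a relation between pairs of points and nonnegative rationals; \<open>d x y q\<close> is
  read \<open>d(x,y) \<le> q\<close>.  Values at negative \<open>q\<close> carry no meaning and are left unconstrained.
\<close>

type_synonym 'a premetric = "'a \<Rightarrow> 'a \<Rightarrow> rat \<Rightarrow> bool"

locale premetric_space =
  fixes X :: "'a set" and d :: "'a premetric"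
  assumes nonempty: "X \<noteq> {}"
    and zero_iff: "\<lbrakk>x \<in> X; y \<in> X\<rbrakk> \<Longrightarrow> d x y 0 \<longleftrightarrow> x = y"
    and sym: "\<lbrakk>x \<in> X; y \<in> X; 0 \<le> q; d x y q\<rbrakk> \<Longrightarrow> d y x q"
    and triangle: "\<lbrakk>x \<in> X; y \<in> X; z \<in> X; 0 \<le> p; 0 \<le> q; d x z p; d z y q\<rbrakk> \<Longrightarrow> d x y (p + q)"
    and upper: "\<lbrakk>x \<in> X; y \<in> X; 0 \<le> p\<rbrakk> \<Longrightarrow> d x y p \<longleftrightarrow> (\<forall>q>p. d x y q)"

definition diam_le :: "'a premetric \<Rightarrow> 'a set \<Rightarrow> rat \<Rightarrow> bool" where
  "diam_le d S q \<longleftrightarrow> (\<forall>x\<in>S. \<forall>y\<in>S. d x y q)"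

definition cauchy_family :: "'a set \<Rightarrow> 'a premetric \<Rightarrow> 'a set set \<Rightarrow> bool" where
  "cauchy_family X d F \<longleftrightarrow>
     F \<subseteq> Pow X \<and> (\<forall>S\<in>F. \<forall>T\<in>F. S \<inter> T \<noteq> {}) \<and> (\<forall>\<epsilon>>0. \<exists>S\<in>F. diam_le d S \<epsilon>)"

definition family_dist :: "'a premetric \<Rightarrow> 'a set set premetric" where
  "family_dist d F F' q \<longleftrightarrow>
     (\<forall>\<epsilon>>0. \<exists>S\<in>F. \<exists>T\<in>F'. diam_le d S \<epsilon> \<and> diam_le d T \<epsilon> \<and> diam_le d (S \<union> T) (q + \<epsilon>))"

definition family_rel :: "'a set \<Rightarrow> 'a premetric \<Rightarrow> ('a set set \<times> 'a set set) set" where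
  "family_rel X d = {(F, F'). cauchy_family X d F \<and> cauchy_family X d F' \<and> family_dist d F F' 0}"

definition family_class :: "'a set \<Rightarrow> 'a premetric \<Rightarrow> 'a set set \<Rightarrow> 'a set set set" where
  "family_class X d F = family_rel X d `` {F}"

definition completion :: "'a set \<Rightarrow> 'a premetric \<Rightarrow> 'a set set set set" where
  "completion X d = {F. cauchy_family X d F} // family_rel X d"

text \<open>
  Defined through some pair of representatives; the choice is immaterial by
  \<open>completion_dist_class\<close> below.
\<close>

definition completion_dist :: "'a premetric \<Rightarrow> 'a set set set premetric" where
  "completion_dist d K K' q \<longleftrightarrow> (\<exists>F\<in>K. \<exists>F'\<in>K'. family_dist d F F' q)"

definition point_class :: "'a set \<Rightarrow> 'a premetric \<Rightarrow> 'a \<Rightarrow> 'a set set set" where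
  "point_class X d x = family_class X d {{x}}"

definition isometric_embedding ::
    "'a set \<Rightarrow> 'a premetric \<Rightarrow> 'b set \<Rightarrow> 'b premetric \<Rightarrow> ('a \<Rightarrow> 'b) \<Rightarrow> bool" where
  "isometric_embedding X dX Y dY f \<longleftrightarrow>
     f \<in> X \<rightarrow> Y \<and> (\<forall>x\<in>X. \<forall>x'\<in>X. \<forall>q\<ge>0. dX x x' q \<longleftrightarrow> dY (f x) (f x') q)"

definition dense_subset :: "'a set \<Rightarrow> 'a set \<Rightarrow> 'a premetric \<Rightarrow> bool" where
  "dense_subset D Y d \<longleftrightarrow> D \<subseteq> Y \<and> (\<forall>\<epsilon>>0. \<forall>y\<in>Y. \<exists>z\<in>D. d z y \<epsilon>)"

context premetric_space
begin

lemma mono: "\<lbrakk>x \<in> X; y \<in> X; 0 \<le> p; p \<le> q; d x y p\<rbrakk> \<Longrightarrow> d x y q"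
  using upper[of x y p] by (cases "p = q") auto

lemma family_dist_refl:
  assumes "cauchy_family X d F"
  shows "family_dist d F F 0"
  using assms unfolding cauchy_family_def family_dist_def by (metis Un_absorb add_0)

lemma family_dist_sym: "family_dist d F F' q \<Longrightarrow> family_dist d F' F q"
  unfolding family_dist_def by (subst Un_commute) blast

lemma family_dist_triangle:
  assumes F: "cauchy_family X d F" and G: "cauchy_family X d G" and H: "cauchy_family X d H"
    and pq: "0 \<le> p" "0 \<le> q" and FG: "family_dist d F G p" and GH: "family_dist d G H q"
  shows "family_dist d F H (p + q)"
  unfolding family_dist_def
proof (intro allI impI)
  fix \<epsilon> :: rat assume e: "0 < \<epsilon>"
  then have e2: "0 < \<epsilon> / 2" by simp
  obtain S T where ST: "S \<in> F" "T \<in> G" "diam_le d S (\<epsilon>/2)" "diam_le d (S \<union> T) (p + \<epsilon>/2)"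
    using FG e2 unfolding family_dist_def by blast
  obtain T' U where TU: "T' \<in> G" "U \<in> H" "diam_le d U (\<epsilon>/2)" "diam_le d (T' \<union> U) (q + \<epsilon>/2)"
    using GH e2 unfolding family_dist_def by blast
  obtain t where t: "t \<in> T" "t \<in> T'"
    using G ST(2) TU(1) unfolding cauchy_family_def by blast
  have "S \<in> Pow X" "U \<in> Pow X" "T \<in> Pow X"
    using F G H ST(1,2) TU(2) unfolding cauchy_family_def by (meson subsetD)+
  then have sub: "S \<subseteq> X" "U \<subseteq> X" "t \<in> X"
    using t by auto
  have dS: "d x y r" if "x \<in> S" "y \<in> S" "\<epsilon>/2 \<le> r" for x y r
    using that ST(3) sub mono[of x y "\<epsilon>/2" r] e unfolding diam_le_def by auto
  have dU: "d x y r" if "x \<in> U" "y \<in> U" "\<epsilon>/2 \<le> r" for x y r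
    using that TU(3) sub mono[of x y "\<epsilon>/2" r] e unfolding diam_le_def by auto
  have dSU: "d x y (p + q + \<epsilon>)" if "x \<in> S" "y \<in> U" for x y
  proof -
    have "d x t (p + \<epsilon>/2)" "d t y (q + \<epsilon>/2)"
      using that t ST(4) TU(4) unfolding diam_le_def by auto
    then have "d x y ((p + \<epsilon>/2) + (q + \<epsilon>/2))"
      using that sub pq e by (intro triangle[of x y t]) auto
    then show ?thesis by (simp add: algebra_simps)
  qed
  have dUS: "d y x (p + q + \<epsilon>)" if "x \<in> S" "y \<in> U" for x y
    using dSU[OF that] that sub pq e by (intro sym[of x y]) auto
  have "diam_le d S \<epsilon>" "diam_le d U \<epsilon>"
    using dS dU e unfolding diam_le_def by auto
  moreover have "diam_le d (S \<union> U) (p + q + \<epsilon>)"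
    unfolding diam_le_def using dS dU dSU dUS e pq by auto
  ultimately show "\<exists>S\<in>F. \<exists>T\<in>H. diam_le d S \<epsilon> \<and> diam_le d T \<epsilon> \<and> diam_le d (S \<union> T) (p + q + \<epsilon>)"
    using ST(1) TU(2) by blast
qed

lemma equiv_family_rel: "equiv {F. cauchy_family X d F} (family_rel X d)"
proof (rule equivI)
  show "family_rel X d \<subseteq> {F. cauchy_family X d F} \<times> {F. cauchy_family X d F}"
    by (auto simp: family_rel_def)
  show "refl_on {F. cauchy_family X d F} (family_rel X d)"
    by (auto simp: refl_on_def family_rel_def family_dist_refl)
  show "Relation.sym (family_rel X d)"
    by (auto simp: sym_def family_rel_def family_dist_sym)
  show "trans (family_rel X d)"
    using family_dist_triangle[where p = 0 and q = 0]
    by (auto simp: trans_def family_rel_def)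
qed

lemma completion_dist_class:
  assumes "cauchy_family X d F" "cauchy_family X d F'" "0 \<le> q"
  shows "completion_dist d (family_class X d F) (family_class X d F') q \<longleftrightarrow> family_dist d F F' q"
proof
  assume "completion_dist d (family_class X d F) (family_class X d F') q"
  then obtain G G' where G: "cauchy_family X d G" "cauchy_family X d G'"
      "family_dist d F G 0" "family_dist d F' G' 0" "family_dist d G G' q"
    by (auto simp: completion_dist_def family_class_def family_rel_def)
  have "family_dist d F G' (0 + q)"
    using assms G by (intro family_dist_triangle[of F G G']) auto
  then have "family_dist d F F' (q + 0)"
    using assms G by (intro family_dist_triangle[of F G' F']) (auto intro: family_dist_sym)
  then show "family_dist d F F' q" by simp
next
  assume "family_dist d F F' q"
  then show "completion_dist d (family_class X d F) (family_class X d F') q"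
    using assms family_dist_refl
    by (auto simp: completion_dist_def family_class_def family_rel_def)
qed

lemma cauchy_family_singleton: "x \<in> X \<Longrightarrow> cauchy_family X d {{x}}"
  using zero_iff[of x x] upper[of x x 0] by (simp add: cauchy_family_def diam_le_def)

lemma point_class_in_completion: "x \<in> X \<Longrightarrow> point_class X d x \<in> completion X d"
  unfolding point_class_def completion_def family_class_def
  by (rule quotientI) (simp add: cauchy_family_singleton)

lemma family_dist_upper:
  assumes F: "cauchy_family X d F" and F': "cauchy_family X d F'" and p: "0 \<le> p"
  shows "family_dist d F F' p \<longleftrightarrow> (\<forall>q>p. family_dist d F F' q)"
proof (intro iffI allI impI)
  fix q assume D: "family_dist d F F' p" and q: "p < q"
  show "family_dist d F F' q"
    unfolding family_dist_def
  proof (intro allI impI)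
    fix \<epsilon> :: rat assume e: "0 < \<epsilon>"
    obtain S T where ST: "S \<in> F" "T \<in> F'" "diam_le d S \<epsilon>" "diam_le d T \<epsilon>"
        "diam_le d (S \<union> T) (p + \<epsilon>)"
      using D e unfolding family_dist_def by blast
    have "S \<in> Pow X" "T \<in> Pow X"
      using F F' ST(1,2) unfolding cauchy_family_def by (meson subsetD)+
    then have sub: "S \<union> T \<subseteq> X" by simp
    have "d x y (q + \<epsilon>)" if "x \<in> S \<union> T" "y \<in> S \<union> T" for x y
    proof (rule mono)
      show "d x y (p + \<epsilon>)" using ST(5) that unfolding diam_le_def by blast
      show "x \<in> X" "y \<in> X" using sub that by blast+
    qed (use p q e in auto)
    then have "diam_le d (S \<union> T) (q + \<epsilon>)"
      unfolding diam_le_def by blast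
    then show "\<exists>S\<in>F. \<exists>T\<in>F'. diam_le d S \<epsilon> \<and> diam_le d T \<epsilon> \<and> diam_le d (S \<union> T) (q + \<epsilon>)"
      using ST by blast
  qed
next
  assume D: "\<forall>q>p. family_dist d F F' q"
  show "family_dist d F F' p"
    unfolding family_dist_def
  proof (intro allI impI)
    fix \<epsilon> :: rat assume e: "0 < \<epsilon>"
    have "family_dist d F F' (p + \<epsilon>/2)" "0 < \<epsilon>/2"
      using D e by auto
    then obtain S T where ST: "S \<in> F" "T \<in> F'" "diam_le d S (\<epsilon>/2)" "diam_le d T (\<epsilon>/2)"
        "diam_le d (S \<union> T) (p + \<epsilon>/2 + \<epsilon>/2)"
      unfolding family_dist_def by blast
    have "S \<in> Pow X" "T \<in> Pow X"
      using F F' ST(1,2) unfolding cauchy_family_def by (meson subsetD)+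
    then have "diam_le d S \<epsilon>" "diam_le d T \<epsilon>"
      using ST(3,4) e mono[of _ _ "\<epsilon>/2" \<epsilon>] unfolding diam_le_def by (auto simp: subset_iff)
    then show "\<exists>S\<in>F. \<exists>T\<in>F'. diam_le d S \<epsilon> \<and> diam_le d T \<epsilon> \<and> diam_le d (S \<union> T) (p + \<epsilon>)"
      using ST by (auto simp: add.assoc)
  qed
qed

lemma completion_eq: "completion X d = family_class X d ` {F. cauchy_family X d F}"
  by (auto simp: completion_def family_class_def quotient_def)

lemma premetric_space_completion: "premetric_space (completion X d) (completion_dist d)"
proof
  show "completion X d \<noteq> {}"
    using nonempty point_class_in_completion by blast
next
  fix K L assume "K \<in> completion X d" "L \<in> completion X d"
  then obtain F G where FG: "cauchy_family X d F" "K = family_class X d F"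
      "cauchy_family X d G" "L = family_class X d G"
    unfolding completion_eq by blast
  have "K = L \<longleftrightarrow> (F, G) \<in> family_rel X d"
    using eq_equiv_class_iff[OF equiv_family_rel] FG by (simp add: family_class_def)
  then show "completion_dist d K L 0 \<longleftrightarrow> K = L"
    using FG by (simp add: completion_dist_class family_rel_def)
next
  fix K L q assume "completion_dist d K L q"
  then show "completion_dist d L K q"
    unfolding completion_dist_def using family_dist_sym by blast
next
  fix K L M and p q :: rat
  assume "K \<in> completion X d" "L \<in> completion X d" "M \<in> completion X d"
    and *: "0 \<le> p" "0 \<le> q" "completion_dist d K M p" "completion_dist d M L q"
  then obtain F G H where "cauchy_family X d F" "K = family_class X d F"
      "cauchy_family X d G" "L = family_class X d G"
      "cauchy_family X d H" "M = family_class X d H"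
    unfolding completion_eq by blast
  then show "completion_dist d K L (p + q)"
    using * family_dist_triangle[of F H G p q] by (simp add: completion_dist_class)
next
  fix K L and p :: rat
  assume "K \<in> completion X d" "L \<in> completion X d" and p: "0 \<le> p"
  then obtain F G where "cauchy_family X d F" "K = family_class X d F"
      "cauchy_family X d G" "L = family_class X d G"
    unfolding completion_eq by blast
  then show "completion_dist d K L p \<longleftrightarrow> (\<forall>q>p. completion_dist d K L q)"
    using p family_dist_upper[of F G p] by (simp add: completion_dist_class)
qed

end

end

theory Submission
  imports Defs
begin

text \<open>
  A point \<open>c\<close> of \<open>C\<close> is sent to the class of the family of the sets
  \<open>f ` {a \<in> A. dC (h a) c \<delta>}\<close>, \<open>\<delta> > 0\<close>.  Density of \<open>h ` A\<close> makes these nested sets nonempty, and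
  since \<open>f\<close> and \<open>h\<close> are isometric, distances in \<open>B\<close> between their points are distances in \<open>C\<close>
  between points \<open>\<delta>\<close>-close to the centres.  Uniqueness holds because isometric embeddings that
  agree on a dense subset agree everywhere.
\<close>

text \<open>For \<open>z\<close> in \<open>D\<close> within q/2 of \<open>x\<close>, both
  \<open>g x\<close> and \<open>g' x\<close> lie within q/2 of the common value
  \<open>g z = g' z\<close>, hence within q of each other. As q > 0 is arbitrary,
  \<open>upper\<close> at 0 and \<open>zero_iff\<close> force equality.\<close>

lemma isometric_embedding_eq_on_dense:
  assumes Y: "premetric_space Y dY"
    and g: "isometric_embedding X dX Y dY g" and g': "isometric_embedding X dX Y dY g'"
    and D: "dense_subset D X dX" and eq: "\<And>z. z \<in> D \<Longrightarrow> g z = g' z" and x: "x \<in> X"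
  shows "g x = g' x"
proof -
  interpret Y: premetric_space Y dY by fact
  have mem: "g y \<in> Y" "g' y \<in> Y" if "y \<in> X" for y
    using g g' that unfolding isometric_embedding_def by auto
  have "dY (g x) (g' x) q" if q: "0 < q" for q
  proof -
    obtain z where z: "z \<in> D" "dX z x (q/2)"
      using D x q unfolding dense_subset_def by (meson half_gt_zero)
    have zX: "z \<in> X"
      using D z(1) unfolding dense_subset_def by blast
    have "dY (g z) (g x) (q/2)" "dY (g' z) (g' x) (q/2)"
      using g g' z(2) zX x q unfolding isometric_embedding_def by auto
    then have "dY (g x) (g' x) (q/2 + q/2)"
      using q zX x eq[OF z(1)] mem Y.sym
      by (intro Y.triangle[where z = "g z"]) auto
    then show ?thesis by simp
  qed
  then have "dY (g x) (g' x) 0"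
    using Y.upper[of "g x" "g' x" 0] mem x by simp
  then show ?thesis
    using Y.zero_iff mem x by blast
qed

locale dense_isometric_span =
  A: premetric_space A dA + B: premetric_space B dB + C: premetric_space C dC
  for A :: "'a set" and dA and B :: "'b set" and dB and C :: "'c set" and dC +
  fixes f :: "'a \<Rightarrow> 'b" and h :: "'a \<Rightarrow> 'c"
  assumes f: "isometric_embedding A dA B dB f"
    and h: "isometric_embedding A dA C dC h"
    and dense: "dense_subset (h ` A) C dC"
begin

definition trace :: "'c \<Rightarrow> rat \<Rightarrow> 'b set" where
  "trace c \<delta> = f ` {a \<in> A. dC (h a) c \<delta>}"

definition trace_family :: "'c \<Rightarrow> 'b set set" where
  "trace_family c = trace c ` {0<..}"

lemma h_in: "a \<in> A \<Longrightarrow> h a \<in> C"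
  using h unfolding isometric_embedding_def by auto

text \<open>Both sides are equivalent to \<open>dA a b q\<close>, so distances pass between
  \<open>B\<close> and \<open>C\<close> along common points of \<open>A\<close>.\<close>

lemma dist_f_iff: "\<lbrakk>a \<in> A; b \<in> A; 0 \<le> q\<rbrakk> \<Longrightarrow> dB (f a) (f b) q \<longleftrightarrow> dC (h a) (h b) q"
  using f h unfolding isometric_embedding_def by auto

lemma trace_subset: "trace c \<delta> \<subseteq> B"
  using f unfolding isometric_embedding_def trace_def by auto

lemma trace_family_memI: "0 < \<delta> \<Longrightarrow> trace c \<delta> \<in> trace_family c"
  unfolding trace_family_def by auto

lemma near_point:
  assumes "c \<in> C" "0 < \<epsilon>" "S \<in> trace_family c"
  obtains a where "a \<in> A" "dC (h a) c \<epsilon>" "f a \<in> S"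
proof -
  obtain \<delta> where \<delta>: "0 < \<delta>" "S = trace c \<delta>"
    using assms(3) unfolding trace_family_def by auto
  \<comment> \<open>The minimum serves two ends: \<delta> puts \<open>f a\<close> into
    \<open>S\<close>, \<epsilon> keeps \<open>h a\<close> close to \<open>c\<close>.\<close>
  obtain a where a: "a \<in> A" "dC (h a) c (min \<delta> \<epsilon>)"
    using dense assms(1,2) \<delta>(1) unfolding dense_subset_def by (metis imageE min_less_iff_conj)
  have "dC (h a) c r" if "min \<delta> \<epsilon> \<le> r" for r
    using C.mono[OF h_in[OF a(1)] assms(1) _ that a(2)] assms(2) \<delta>(1) by simp
  then show thesis
    using that[of a] a(1) \<delta>(2) unfolding trace_def by auto
qed

text \<open>The path \<open>h a\<close>, \<open>c\<close>, \<open>c'\<close>, \<open>h b\<close> has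
  length at most \<epsilon>/2 + q + \<epsilon>/2, and \<open>dist_f_iff\<close> carries this bound
  to \<open>B\<close>. The case \<open>c = c'\<close>, \<open>q = 0\<close> bounds the diameter of a
  single trace.\<close>

lemma dist_trace:
  assumes "c \<in> C" "c' \<in> C" "0 \<le> q" "dC c c' q" "0 < \<epsilon>"
    and x: "x \<in> trace c (\<epsilon>/2)" and y: "y \<in> trace c' (\<epsilon>/2)"
  shows "dB x y (q + \<epsilon>)"
proof -
  obtain a b where ab: "a \<in> A" "b \<in> A" "x = f a" "y = f b"
      "dC (h a) c (\<epsilon>/2)" "dC (h b) c' (\<epsilon>/2)"
    using x y unfolding trace_def by auto
  note mem = h_in[OF ab(1)] h_in[OF ab(2)]
  have "dC (h a) c' (\<epsilon>/2 + q)"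
    using assms ab mem by (intro C.triangle[where z = c]) auto
  moreover have "dC c' (h b) (\<epsilon>/2)"
    using C.sym assms ab mem by auto
  ultimately have "dC (h a) (h b) (\<epsilon>/2 + q + \<epsilon>/2)"
    using C.triangle[of "h a" "h b" c' "\<epsilon>/2 + q" "\<epsilon>/2"] assms mem by simp
  then show ?thesis
    using dist_f_iff[of a b "q + \<epsilon>"] ab assms by (simp add: algebra_simps)
qed

lemma diam_trace: "\<lbrakk>c \<in> C; 0 < \<epsilon>\<rbrakk> \<Longrightarrow> diam_le dB (trace c (\<epsilon>/2)) \<epsilon>"
  unfolding diam_le_def using dist_trace[of c c 0 \<epsilon>] C.zero_iff by auto

lemma cauchy_trace_family:
  assumes c: "c \<in> C"
  shows "cauchy_family B dB (trace_family c)"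
  unfolding cauchy_family_def
proof (intro conjI ballI allI impI)
  show "trace_family c \<subseteq> Pow B"
    unfolding trace_family_def using trace_subset by auto
next
  fix S T assume S: "S \<in> trace_family c" and T: "T \<in> trace_family c"
  obtain \<delta> \<delta>' where d: "0 < \<delta>" "S = trace c \<delta>" "0 < \<delta>'" "T = trace c \<delta>'"
    using S T unfolding trace_family_def by auto
  \<comment> \<open>With the radius of \<open>T\<close> as tolerance, the point found in
    \<open>S\<close> also lies in \<open>T\<close>.\<close>
  obtain a where a: "a \<in> A" "dC (h a) c \<delta>'" "f a \<in> S"
    using near_point[OF c d(3) S] by blast
  then have "f a \<in> T"
    using d(4) unfolding trace_def by blast
  then show "S \<inter> T \<noteq> {}"
    using a(3) by blast
next
  fix \<epsilon> :: rat assume "0 < \<epsilon>"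
  then show "\<exists>S\<in>trace_family c. diam_le dB S \<epsilon>"
    using diam_trace[OF c] trace_family_memI[of "\<epsilon>/2" c] by auto
qed

lemma family_dist_trace_family:
  assumes c: "c \<in> C" "c' \<in> C" and q: "0 \<le> q"
  shows "family_dist dB (trace_family c) (trace_family c') q \<longleftrightarrow> dC c c' q"
proof
  assume cc': "dC c c' q"
  show "family_dist dB (trace_family c) (trace_family c') q"
    unfolding family_dist_def
  proof (intro allI impI)
    fix \<epsilon> :: rat assume e: "0 < \<epsilon>"
    let ?S = "trace c (\<epsilon>/2)" and ?T = "trace c' (\<epsilon>/2)"
    note diam = diam_trace[OF c(1) e] diam_trace[OF c(2) e]
    have "dB x y (q + \<epsilon>)" if xy: "x \<in> ?S \<union> ?T" "y \<in> ?S \<union> ?T" for x y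
    proof -
      have inB: "x \<in> B" "y \<in> B"
        using xy trace_subset by blast+
      \<comment> \<open>Two points of one trace are within \<epsilon>; mixed pairs fall under
        \<open>dist_trace\<close>, used in both orders.\<close>
      have "dB x y (q + \<epsilon>)" if "dB x y \<epsilon>"
        using B.mono[OF inB _ _ that] e q by simp
      moreover have "dC c' c q"
        using C.sym c q cc' by blast
      ultimately show ?thesis
        using xy diam dist_trace[OF c q cc' e] dist_trace[OF c(2,1) q _ e]
        unfolding diam_le_def by blast
    qed
    then have "diam_le dB (?S \<union> ?T) (q + \<epsilon>)"
      unfolding diam_le_def by blast
    then show "\<exists>S\<in>trace_family c. \<exists>T\<in>trace_family c'.
        diam_le dB S \<epsilon> \<and> diam_le dB T \<epsilon> \<and> diam_le dB (S \<union> T) (q + \<epsilon>)"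
      using diam e trace_family_memI[of "\<epsilon>/2"] by auto
  qed
next
  assume D: "family_dist dB (trace_family c) (trace_family c') q"
  have "dC c c' r" if r: "q < r" for r
  proof -
    \<comment> \<open>The slack r - q is split in three: one error at each end of the path
      \<open>c\<close>, \<open>h a\<close>, \<open>h b\<close>, \<open>c'\<close>, and one from the
      diameter of \<open>S \<union> T\<close>.\<close>
    define \<epsilon> where "\<epsilon> = (r - q) / 3"
    have e: "0 < \<epsilon>" and r_eq: "\<epsilon> + (q + \<epsilon>) + \<epsilon> = r"
      using r by (auto simp: \<epsilon>_def field_simps)
    obtain S T where ST: "S \<in> trace_family c" "T \<in> trace_family c'" "diam_le dB (S \<union> T) (q + \<epsilon>)"
      using D e unfolding family_dist_def by blast
    obtain a where a: "a \<in> A" "dC (h a) c \<epsilon>" "f a \<in> S"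
      using near_point[OF c(1) e ST(1)] by blast
    obtain b where b: "b \<in> A" "dC (h b) c' \<epsilon>" "f b \<in> T"
      using near_point[OF c(2) e ST(2)] by blast
    note mem = h_in[OF a(1)] h_in[OF b(1)]
    have "dB (f a) (f b) (q + \<epsilon>)"
      using ST(3) a(3) b(3) unfolding diam_le_def by blast
    then have ab: "dC (h a) (h b) (q + \<epsilon>)"
      using dist_f_iff a(1) b(1) q e by simp
    have "dC c (h a) \<epsilon>"
      using C.sym[OF mem(1) c(1) _ a(2)] e by simp
    then have "dC c (h b) (\<epsilon> + (q + \<epsilon>))"
      using C.triangle[of c "h b" "h a" \<epsilon> "q + \<epsilon>"] ab c mem q e by simp
    then have "dC c c' (\<epsilon> + (q + \<epsilon>) + \<epsilon>)"
      using C.triangle[of c c' "h b" "\<epsilon> + (q + \<epsilon>)" \<epsilon>] b(2) c mem q e by simp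
    then show ?thesis
      using r_eq by simp
  qed
  then show "dC c c' q"
    using C.upper[OF c q] by blast
qed

text \<open>Restricting to \<open>C\<close> fixes the values elsewhere, so that uniqueness can be
  stated as equality of total functions.\<close>

definition extension :: "'c \<Rightarrow> 'b set set set" where
  "extension = (\<lambda>c\<in>C. family_class B dB (trace_family c))"

lemma isometric_embedding_extension:
  "isometric_embedding C dC (completion B dB) (completion_dist dB) extension"
  unfolding isometric_embedding_def extension_def B.completion_eq
  by (auto simp: cauchy_trace_family B.completion_dist_class family_dist_trace_family)

text \<open>Since \<open>f a\<close> belongs to every trace of positive radius around
  \<open>h a\<close>, joining \<open>{f a}\<close> to such a trace leaves its diameter unchanged.
  The trace family and \<open>{{f a}}\<close> are therefore at distance 0.\<close>

lemma extension_h: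
  assumes a: "a \<in> A"
  shows "extension (h a) = point_class B dB (f a)"
proof -
  have fa: "f a \<in> B"
    using f a unfolding isometric_embedding_def by auto
  have "family_dist dB (trace_family (h a)) {{f a}} 0"
    unfolding family_dist_def
  proof (intro allI impI)
    fix \<epsilon> :: rat assume e: "0 < \<epsilon>"
    let ?S = "trace (h a) (\<epsilon>/2)"
    have "dC (h a) (h a) (\<epsilon>/2)"
      using C.mono[of "h a" "h a" 0 "\<epsilon>/2"] C.zero_iff h_in[OF a] e by simp
    then have "f a \<in> ?S"
      using a unfolding trace_def by blast
    moreover note diam = diam_trace[OF h_in[OF a] e]
    ultimately have "diam_le dB {f a} \<epsilon>" "diam_le dB (?S \<union> {f a}) (0 + \<epsilon>)"
      unfolding diam_le_def by auto
    then show "\<exists>S\<in>trace_family (h a). \<exists>T\<in>{{f a}}.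
        diam_le dB S \<epsilon> \<and> diam_le dB T \<epsilon> \<and> diam_le dB (S \<union> T) (0 + \<epsilon>)"
      using diam trace_family_memI[of "\<epsilon>/2" "h a"] e by (meson half_gt_zero insertI1)
  qed
  then have "(trace_family (h a), {{f a}}) \<in> family_rel B dB"
    unfolding family_rel_def
    using cauchy_trace_family[OF h_in[OF a]] B.cauchy_family_singleton[OF fa] by simp
  then show ?thesis
    using equiv_class_eq[OF B.equiv_family_rel] h_in[OF a]
    by (simp add: extension_def point_class_def family_class_def)
qed

end

theorem theorem3p2:
  fixes A :: "'a set" and dA :: "'a premetric"
    and B :: "'b set" and dB :: "'b premetric"
    and C :: "'c set" and dC :: "'c premetric"
    and f :: "'a \<Rightarrow> 'b" and h :: "'a \<Rightarrow> 'c"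
  assumes "premetric_space A dA"
    and "premetric_space B dB"
    and "premetric_space C dC"
    and "isometric_embedding A dA B dB f"
    and "isometric_embedding A dA C dC h"
    and "dense_subset (h ` A) C dC"
  shows "\<exists>!g. g \<in> extensional C \<and>
              isometric_embedding C dC (completion B dB) (completion_dist dB) g \<and>
              (\<forall>a\<in>A. g (h a) = point_class B dB (f a))"
proof -
  interpret dense_isometric_span A dA B dB C dC f h
    using assms by (simp add: dense_isometric_span_def dense_isometric_span_axioms_def)
  show ?thesis
  proof (rule ex1I[of _ extension])
    show "extension \<in> extensional C \<and>
        isometric_embedding C dC (completion B dB) (completion_dist dB) extension \<and>
        (\<forall>a\<in>A. extension (h a) = point_class B dB (f a))"
      using isometric_embedding_extension extension_h by (simp add: extension_def)
  next
    fix g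
    assume g: "g \<in> extensional C \<and>
        isometric_embedding C dC (completion B dB) (completion_dist dB) g \<and>
        (\<forall>a\<in>A. g (h a) = point_class B dB (f a))"
    have "g c = extension c" if "c \<in> C" for c
      using isometric_embedding_eq_on_dense[OF B.premetric_space_completion _
          isometric_embedding_extension dense _ that, of g] g extension_h by auto
    then show "g = extension"
      using g by (intro extensionalityI[of _ C]) (auto simp: extension_def)
  qed
qed

end
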